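(* For every integer $n\ge 3$ we have $f(n)=L(n)$ or $f(n)=L(n)-1$.
   Context: For an integer $n\ge 3$, $f(n)$ denotes the least positive integer $k$ such that $\binom{n}{k}>\frac{2^n}{n+1}$, and $L(n)$ denotes the least positive integer $k$ such that $\binom{n}{k}>\frac{2^n}{n}$. (Such $k$ exist for all $n\ge 3$.) *)

theory Defs
  imports Complex_Main
begin

definition f :: "nat \<Rightarrow> nat" where
  "f n = (LEAST k. k > 0 \<and> real (n choose k) > 2 ^ n / (real n + 1))"

definition L :: "nat \<Rightarrow> nat" where
  "L n = (LEAST k. k > 0 \<and> real (n choose k) > 2 ^ n / real n)"

text \<open>For \<open>n \<ge> 3\<close> both minima are taken over nonempty sets, so \<open>f n\<close> and \<open>L n\<close> are meaningful.\<close>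

lemma ex_L:
  assumes "n \<ge> 3"
  shows "\<exists>k>0. real (n choose k) > 2 ^ n / real n"
proof (rule ccontr)
  assume "\<not> ?thesis"
  then have le: "real (n choose k) \<le> 2 ^ n / real n" if "k > 0" for k
    using that by (meson not_less)
  obtain m where m: "n = Suc m" using assms by (cases n) auto
  have "(2::real) ^ n = (\<Sum>k\<le>n. real (n choose k))"
    using choose_row_sum[of n] by (metis of_nat_numeral of_nat_power of_nat_sum)
  also have "\<dots> = 2 + (\<Sum>k<m. real (n choose Suc k))"
    unfolding m by (subst sum.atMost_Suc_shift) (simp flip: lessThan_Suc_atMost)
  also have "\<dots> \<le> 2 + (\<Sum>k<m. 2 ^ n / real n)"
    by (intro add_left_mono sum_mono le) simp
  also have "\<dots> = 2 + (real n - 1) * (2 ^ n / real n)"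
    by (simp add: m)
  finally have "(2::real) ^ n \<le> 2 * real n"
    using assms by (simp add: field_simps)
  then have "2 ^ n \<le> 2 * n"
    by (metis of_nat_le_iff of_nat_mult of_nat_numeral of_nat_power)
  moreover have "2 ^ n > 2 * n"
    using assms by (induction n rule: dec_induct) auto
  ultimately show False by simp
qed

lemma ex_f:
  assumes "n \<ge> 3"
  shows "\<exists>k>0. real (n choose k) > 2 ^ n / (real n + 1)"
proof -
  have "2 ^ n / (real n + 1) \<le> 2 ^ n / real n"
    using assms by (intro divide_left_mono) auto
  then show ?thesis using ex_L[OF assms] by (meson le_less_trans)
qed

end

theory Submission
  imports Defs
begin

text \<open>
  Lowering the threshold from \<open>2 ^ n / n\<close> to \<open>2 ^ n / (n + 1)\<close> can only move the first crossing to
  the left, so \<open>f n \<le> L n\<close>. It moves by at most one place because, as long as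
  \<open>k + 1 \<le> n / 2\<close>, passing from \<open>n choose k\<close> to \<open>n choose Suc k\<close> multiplies by
  \<open>(n - k) / (k + 1) \<ge> (n + 1) / n\<close>, and this is exactly the ratio of the two thresholds: one step
  after the lower threshold is exceeded, so is the higher one
  (\<open>binomial_exceeds_next_threshold\<close>). The step never has to be taken across the middle, since the
  central coefficient is the largest of its row and hence \<open>L n \<le> n div 2\<close>.
\<close>

text \<open>
  After clearing denominators the claim about the ratio is \<open>(2 * n + 1) * k \<le> n\<^sup>2 - n - 1\<close>. For
  \<open>k \<le> n / 2 - 1\<close> the left side is at most \<open>n\<^sup>2 - 3 * n / 2 - 1\<close>, leaving \<open>n / 2\<close> to spare. For
  larger \<open>k\<close> the row no longer increases from \<open>k\<close> to \<open>k + 1\<close>, so the range of \<open>k\<close> cannot be extended.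
\<close>

lemma binomial_step_growth:
  assumes "2 * Suc k \<le> n"
  shows "(real n + 1) * real (n choose k) \<le> real n * real (n choose Suc k)"
proof -
  have kn: "2 * (real k + 1) \<le> real n"
    using of_nat_mono[OF assms, where 'a = real] by simp
  have "(2 * real n + 1) * (2 * (real k + 1)) \<le> (2 * real n + 1) * real n"
    using kn by (intro mult_left_mono) auto
  then have ratio: "(real n + 1) * (real k + 1) \<le> real n * (real n - real k)"
    by (simp add: algebra_simps)
  have step: "(real k + 1) * real (n choose Suc k) = (real n - real k) * real (n choose k)"
  proof -
    have "Suc k * (n choose Suc k) = (n - k) * (n choose k)"
      by (metis binomial_absorb_comp binomial_absorption)
    then have "real (Suc k) * real (n choose Suc k) = real (n - k) * real (n choose k)"
      by (metis of_nat_mult)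
    then show ?thesis
      using assms by (simp add: of_nat_diff add.commute)
  qed
  have "(real k + 1) * ((real n + 1) * real (n choose k))
      = ((real n + 1) * (real k + 1)) * real (n choose k)"
    by simp
  also have "\<dots> \<le> (real n * (real n - real k)) * real (n choose k)"
    using ratio by (intro mult_right_mono) auto
  also have "\<dots> = (real k + 1) * (real n * real (n choose Suc k))"
    using step by (simp add: mult.assoc mult.left_commute)
  finally show ?thesis
    by (simp add: mult_le_cancel_left)
qed

lemma binomial_exceeds_next_threshold:
  assumes "2 * Suc k \<le> n" and "real (n choose k) > 2 ^ n / (real n + 1)"
  shows "real (n choose Suc k) > 2 ^ n / real n"
proof -
  have "2 ^ n < (real n + 1) * real (n choose k)"
    using assms(2) by (simp add: field_simps)
  also have "\<dots> \<le> real n * real (n choose Suc k)"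
    using assms(1) by (rule binomial_step_growth)
  finally show ?thesis
    using assms(1) by (simp add: field_simps)
qed

lemma f_spec:
  assumes "n \<ge> 3"
  shows "f n > 0 \<and> real (n choose f n) > 2 ^ n / (real n + 1)"
  unfolding f_def using ex_f[OF assms] by (rule LeastI_ex)

lemma L_spec:
  assumes "n \<ge> 3"
  shows "L n > 0 \<and> real (n choose L n) > 2 ^ n / real n"
  unfolding L_def using ex_L[OF assms] by (rule LeastI_ex)

lemma L_le:
  assumes "k > 0" and "real (n choose k) > 2 ^ n / real n"
  shows "L n \<le> k"
  unfolding L_def using assms by (intro Least_le) auto

lemma f_le_L:
  assumes "n \<ge> 3"
  shows "f n \<le> L n"
proof -
  have "2 ^ n / (real n + 1) \<le> 2 ^ n / real n"
    using assms by (intro divide_left_mono) auto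
  then show ?thesis
    unfolding f_def using L_spec[OF assms] by (intro Least_le) auto
qed

lemma L_le_half:
  assumes "n \<ge> 3"
  shows "L n \<le> n div 2"
proof (rule L_le)
  show "n div 2 > 0"
    using assms by simp
  have "real (n choose L n) \<le> real (n choose (n div 2))"
    using binomial_maximum[of n "L n"] by simp
  then show "real (n choose (n div 2)) > 2 ^ n / real n"
    using L_spec[OF assms] by linarith
qed

theorem theorem1p3:
  fixes n :: nat
  assumes "n \<ge> 3"
  shows "f n = L n \<or> int (f n) = int (L n) - 1"
proof (cases "f n = L n")
  case False
  then have less: "Suc (f n) \<le> L n"
    using f_le_L[OF assms] by simp
  then have "2 * Suc (f n) \<le> n"
    using L_le_half[OF assms] by simp
  then have "L n \<le> Suc (f n)"
    using f_spec[OF assms] by (intro L_le binomial_exceeds_next_threshold) auto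
  with less show ?thesis
    by simp
qed simp

end
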